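(* Let $\theta>1$ and consider the postdoc (second-best choice) game with $N$ candidates presented in an order drawn from the Mallows distribution with parameter $\theta$. There is a nonnegative integer $k(\theta)$, depending on $\theta$ but not on $N$, such that as $N\to\infty$ the optimal strategy is to reject the first $k(\theta)$ candidates and then select the next candidate that is a left-to-right second maximum.
   Context: Candidates are ranked $1,\dots,N$ ($N$ best, $N-1$ second best). The interview order is a permutation $\pi=[\pi_1\cdots\pi_N]\in S_N$ (the $i$-th interviewed candidate has rank $\pi_i$), drawn with probability $\theta^{\mathrm{inv}(\pi)}/\sum_{\rho\in S_N}\theta^{\mathrm{inv}(\rho)}$, where $\mathrm{inv}(\pi)$ is the number of pairs $i<j$ with $\pi_i>\pi_j$ (Mallows distribution). At time $i$ the decision maker knows only the relative order of $\pi_1,\dots,\pi_i$ and must irrevocably accept or reject candidate $i$; the game is won if the accepted candidate has rank $N-1$. Candidate $i$ is a left-to-right maximum if $\pi_i>\pi_j$ for all $j<i$, and a left-to-right second maximum if exactly one $j<i$ has $\pi_j>\pi_i$. *)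

theory Defs
  imports "HOL-Combinatorics.Permutations" "HOL-Probability.Probability"
begin

text \<open>A permutation \<open>\<pi>\<close> of \<open>{1..N}\<close> is an interview order: \<open>\<pi> i\<close> is the rank of the
  \<open>i\<close>-th interviewed candidate, and rank \<open>N\<close> is the best.\<close>

definition inv_count :: "nat \<Rightarrow> (nat \<Rightarrow> nat) \<Rightarrow> nat" where
  "inv_count N \<pi> = card {(i, j). i \<in> {1..N} \<and> j \<in> {1..N} \<and> i < j \<and> \<pi> i > \<pi> j}"

definition mallows :: "real \<Rightarrow> nat \<Rightarrow> (nat \<Rightarrow> nat) pmf" where
  "mallows \<theta> N = embed_pmf (\<lambda>\<pi>. if \<pi> permutes {1..N}
     then \<theta> ^ inv_count N \<pi> / (\<Sum>\<rho> | \<rho> permutes {1..N}. \<theta> ^ inv_count N \<rho>) else 0)"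

text \<open>For positive parameter, the weights are nonnegative with total mass one, so \<open>embed_pmf\<close>
  indeed yields the distribution with these weights.\<close>

lemma pmf_mallows:
  assumes "\<theta> > 0"
  shows "pmf (mallows \<theta> N) \<pi> = (if \<pi> permutes {1..N}
     then \<theta> ^ inv_count N \<pi> / (\<Sum>\<rho> | \<rho> permutes {1..N}. \<theta> ^ inv_count N \<rho>) else 0)"
  unfolding mallows_def
proof (rule pmf_embed_pmf)
  let ?S = "{\<rho>. \<rho> permutes {1..N}}"
  let ?Z = "\<Sum>\<rho>\<in>?S. \<theta> ^ inv_count N \<rho>"
  let ?f = "\<lambda>\<pi>. if \<pi> permutes {1..N} then \<theta> ^ inv_count N \<pi> / ?Z else 0"
  have fin: "finite ?S" by (rule finite_permutations) simp
  have ne: "?S \<noteq> {}" using permutes_id by blast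
  have Z: "?Z > 0" using fin ne assms by (intro sum_pos) auto
  show nonneg: "0 \<le> ?f \<pi>" for \<pi> using assms Z by auto
  have "(\<integral>\<^sup>+ \<pi>. ennreal (?f \<pi>) \<partial>count_space UNIV) = (\<Sum>\<pi>\<in>?S. ennreal (?f \<pi>))"
    using fin by (intro nn_integral_count_space') auto
  also have "\<dots> = ennreal (\<Sum>\<pi>\<in>?S. ?f \<pi>)" by (rule sum_ennreal) (rule nonneg)
  also have "(\<Sum>\<pi>\<in>?S. ?f \<pi>) = (\<Sum>\<pi>\<in>?S. \<theta> ^ inv_count N \<pi> / ?Z)"
    by (rule sum.cong) auto
  also have "\<dots> = 1" using Z by (simp flip: sum_divide_distrib)
  finally show "(\<integral>\<^sup>+ \<pi>. ennreal (?f \<pi>) \<partial>count_space UNIV) = 1" by simp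
qed

definition ltr_second_max :: "(nat \<Rightarrow> nat) \<Rightarrow> nat \<Rightarrow> bool" where
  "ltr_second_max \<pi> i \<longleftrightarrow> (\<exists>!j. j \<in> {1..<i} \<and> \<pi> j > \<pi> i)"

definition same_rel_order :: "nat \<Rightarrow> (nat \<Rightarrow> nat) \<Rightarrow> (nat \<Rightarrow> nat) \<Rightarrow> bool" where
  "same_rel_order i \<pi> \<rho> \<longleftrightarrow> (\<forall>a\<in>{1..i}. \<forall>b\<in>{1..i}. \<pi> a < \<pi> b \<longleftrightarrow> \<rho> a < \<rho> b)"

text \<open>A strategy is a decision rule \<open>d\<close>, where \<open>d i \<pi>\<close> means: accept candidate \<open>i\<close> if none of the
  candidates \<open>1, \<dots>, i - 1\<close> has been accepted. It may use only the relative order of the first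
  \<open>i\<close> candidates; its own earlier decisions are functions of this information.\<close>

definition strategy :: "nat \<Rightarrow> (nat \<Rightarrow> (nat \<Rightarrow> nat) \<Rightarrow> bool) \<Rightarrow> bool" where
  "strategy N d \<longleftrightarrow> (\<forall>i\<in>{1..N}. \<forall>\<pi> \<rho>. \<pi> permutes {1..N} \<longrightarrow> \<rho> permutes {1..N} \<longrightarrow>
     same_rel_order i \<pi> \<rho> \<longrightarrow> d i \<pi> = d i \<rho>)"

definition selects :: "(nat \<Rightarrow> (nat \<Rightarrow> nat) \<Rightarrow> bool) \<Rightarrow> (nat \<Rightarrow> nat) \<Rightarrow> nat \<Rightarrow> bool" where
  "selects d \<pi> i \<longleftrightarrow> d i \<pi> \<and> (\<forall>j\<in>{1..<i}. \<not> d j \<pi>)"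

definition win_prob :: "real \<Rightarrow> nat \<Rightarrow> (nat \<Rightarrow> (nat \<Rightarrow> nat) \<Rightarrow> bool) \<Rightarrow> real" where
  "win_prob \<theta> N d =
     measure_pmf.prob (mallows \<theta> N) {\<pi>. \<exists>i\<in>{1..N}. selects d \<pi> i \<and> \<pi> i = N - 1}"

definition optimal_strategy :: "real \<Rightarrow> nat \<Rightarrow> (nat \<Rightarrow> (nat \<Rightarrow> nat) \<Rightarrow> bool) \<Rightarrow> bool" where
  "optimal_strategy \<theta> N d \<longleftrightarrow>
     strategy N d \<and> (\<forall>d'. strategy N d' \<longrightarrow> win_prob \<theta> N d' \<le> win_prob \<theta> N d)"

definition reject_then_second_max :: "nat \<Rightarrow> nat \<Rightarrow> (nat \<Rightarrow> nat) \<Rightarrow> bool" where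
  "reject_then_second_max k i \<pi> \<longleftrightarrow> i > k \<and> ltr_second_max \<pi> i"

end

theory Submission
  imports Defs
begin

text \<open>The Lehmer code \<open>c i = card {j < i. \<pi> j > \<pi> i}\<close> turns the Mallows distribution into a product
  measure, \<open>c i\<close> taking the value \<open>x < i\<close> with probability proportional to \<open>\<theta> ^ x\<close>, so that backward
  induction applies. After normalisation, accepting a left-to-right second maximum at time \<open>n\<close> is
  worth \<open>(1 - q ^ n) * (1 - q ^ (n - 1))\<close> with \<open>q = 1 / \<theta>\<close>, which increases with \<open>n\<close> and does not
  depend on \<open>N\<close>, whereas the value of continuing decreases with \<open>n\<close>: this gives a threshold.
  Accepting a left-to-right maximum never beats continuing: from a maximum one wins through the
  second-best reward, reached with chance \<open>1 / [n]\<close> at each step, and the free player is offered that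
  same reward with the larger chance \<open>\<theta> / [n]\<close>. Finally, the value of continuing increases with \<open>N\<close>
  and is \<open>O(q ^ n)\<close> uniformly in \<open>N\<close>, so the threshold is nondecreasing and bounded in \<open>N\<close>, hence
  eventually constant.\<close>

section \<open>Lehmer codes\<close>

definition lehmer :: "(nat \<Rightarrow> nat) \<Rightarrow> nat \<Rightarrow> nat" where
  "lehmer \<pi> i = card {j \<in> {1..<i}. \<pi> i < \<pi> j}"

definition codes :: "nat \<Rightarrow> (nat \<Rightarrow> nat) set" where
  "codes n = PiE {1..n} (\<lambda>i. {..<i})"

lemma lehmer_less: "0 < i \<Longrightarrow> lehmer \<pi> i < i"
proof -
  assume "0 < i"
  have "lehmer \<pi> i \<le> card {1..<i}"
    unfolding lehmer_def by (intro card_mono) auto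
  with \<open>0 < i\<close> show ?thesis by simp
qed

lemma lehmer_in_codes: "restrict (lehmer \<pi>) {1..n} \<in> codes n"
  by (auto simp: codes_def intro: lehmer_less)

lemma lehmer_eq_1_iff: "lehmer \<pi> i = 1 \<longleftrightarrow> ltr_second_max \<pi> i"
proof -
  have "card {x \<in> A. P x} = 1 \<longleftrightarrow> (\<exists>!x. x \<in> A \<and> P x)" for A :: "nat set" and P
    unfolding card_1_singleton_iff One_nat_def Ex1_def by (auto simp: set_eq_iff)
  then show ?thesis unfolding lehmer_def ltr_second_max_def .
qed

lemma lehmer_cong:
  assumes "same_rel_order i \<pi> \<rho>" "j \<in> {1..i}"
  shows "lehmer \<pi> j = lehmer \<rho> j"
proof -
  have "{l \<in> {1..<j}. \<pi> j < \<pi> l} = {l \<in> {1..<j}. \<rho> j < \<rho> l}"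
    using assms by (auto simp: same_rel_order_def)
  then show ?thesis by (simp add: lehmer_def)
qed

text \<open>Upper sets of one linear order are nested, so equal cardinality forces them to
  coincide.\<close>

lemma upset_eq_if_card_eq:
  fixes \<pi> \<rho> :: "'a \<Rightarrow> nat"
  assumes "finite A" and order: "\<And>a b. a \<in> A \<Longrightarrow> b \<in> A \<Longrightarrow> \<pi> a < \<pi> b \<longleftrightarrow> \<rho> a < \<rho> b"
    and inj: "inj_on \<pi> A"
    and card: "card {a \<in> A. s < \<pi> a} = card {a \<in> A. t < \<rho> a}"
  shows "{a \<in> A. s < \<pi> a} = {a \<in> A. t < \<rho> a}"
proof -
  have "{a \<in> A. s < \<pi> a} \<subseteq> {a \<in> A. t < \<rho> a} \<or> {a \<in> A. t < \<rho> a} \<subseteq> {a \<in> A. s < \<pi> a}"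
  proof (rule ccontr)
    assume "\<not> ?thesis"
    then obtain x y where "x \<in> A" "s < \<pi> x" "\<not> t < \<rho> x" "y \<in> A" "t < \<rho> y" "\<not> s < \<pi> y"
      by blast
    then show False using order[of x y] order[of y x] by linarith
  qed
  then show ?thesis using \<open>finite A\<close> card
    by (metis (no_types, lifting) card_subset_eq finite_Collect_conjI finite_subset mem_Collect_eq subsetI)
qed

text \<open>Induction on time: once the order of the first \<open>i\<close> values is known, the
  entry at \<open>Suc i\<close> tells how many of them lie above the new value, and hence which
  ones.\<close>

lemma same_rel_order_if_lehmer_eq:
  assumes "inj_on \<pi> {1..i}" "inj_on \<rho> {1..i}"
    and "\<And>j. j \<in> {1..i} \<Longrightarrow> lehmer \<pi> j = lehmer \<rho> j"
  shows "same_rel_order i \<pi> \<rho>"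
  using assms
proof (induction i)
  case 0
  then show ?case by (simp add: same_rel_order_def)
next
  case (Suc i)
  have sub: "{1..i} \<subseteq> {1..Suc i}" by auto
  have IH: "same_rel_order i \<pi> \<rho>"
    using Suc.prems sub by (intro Suc.IH) (auto intro: inj_on_subset)
  have "{a \<in> {1..i}. \<pi> (Suc i) < \<pi> a} = {a \<in> {1..i}. \<rho> (Suc i) < \<rho> a}"
    using IH Suc.prems(3)[of "Suc i"] inj_on_subset[OF Suc.prems(1) sub]
    by (intro upset_eq_if_card_eq)
      (auto simp: same_rel_order_def lehmer_def atLeastLessThanSuc_atLeastAtMost)
  then have gt: "\<pi> (Suc i) < \<pi> a \<longleftrightarrow> \<rho> (Suc i) < \<rho> a" if "a \<in> {1..i}" for a
    using that by blast
  have ne: "\<pi> (Suc i) \<noteq> \<pi> a" "\<rho> (Suc i) \<noteq> \<rho> a" if "a \<in> {1..i}" for a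
    using inj_onD[OF Suc.prems(1), of "Suc i" a] inj_onD[OF Suc.prems(2), of "Suc i" a] that
    by auto
  have lt: "\<pi> a < \<pi> (Suc i) \<longleftrightarrow> \<rho> a < \<rho> (Suc i)" if "a \<in> {1..i}" for a
    using gt[OF that] ne[OF that] by linarith
  show ?case
    unfolding same_rel_order_def
  proof (intro ballI)
    fix a b assume "a \<in> {1..Suc i}" "b \<in> {1..Suc i}"
    then show "\<pi> a < \<pi> b \<longleftrightarrow> \<rho> a < \<rho> b"
      using IH gt[of b] lt[of a]
      by (cases "a = Suc i"; cases "b = Suc i") (auto simp: same_rel_order_def)
  qed
qed

lemma card_greater_permutes:
  assumes "\<pi> permutes {1..N}"
  shows "card {j \<in> {1..N}. \<pi> i < \<pi> j} = N - \<pi> i"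
proof -
  have "\<pi> ` {j \<in> {1..N}. \<pi> i < \<pi> j} = {\<pi> i<..N}"
  proof (intro equalityI subsetI)
    fix y assume "y \<in> {\<pi> i<..N}"
    moreover from this obtain j where "j \<in> {1..N}" "y = \<pi> j"
      using permutes_image[OF assms] by (metis imageE atLeastAtMost_iff greaterThanAtMost_iff
          less_one linorder_not_le not_less_zero order_less_le_trans)
    ultimately show "y \<in> \<pi> ` {j \<in> {1..N}. \<pi> i < \<pi> j}" by auto
  next
    fix y assume "y \<in> \<pi> ` {j \<in> {1..N}. \<pi> i < \<pi> j}"
    then show "y \<in> {\<pi> i<..N}"
      using permutes_in_image[OF assms] by auto
  qed
  moreover have "inj_on \<pi> {j \<in> {1..N}. \<pi> i < \<pi> j}"
    using permutes_inj[OF assms] by (rule inj_on_subset) auto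
  ultimately show ?thesis by (metis card_greaterThanAtMost card_image)
qed

lemma permutes_eq_if_same_rel_order:
  assumes "\<pi> permutes {1..N}" "\<rho> permutes {1..N}" "same_rel_order N \<pi> \<rho>"
  shows "\<pi> = \<rho>"
proof
  fix i
  show "\<pi> i = \<rho> i"
  proof (cases "i \<in> {1..N}")
    case True
    then have "{j \<in> {1..N}. \<pi> i < \<pi> j} = {j \<in> {1..N}. \<rho> i < \<rho> j}"
      using assms(3) by (auto simp: same_rel_order_def)
    \<comment> \<open>A rank is recovered from the number of candidates above it.\<close>
    then have "N - \<pi> i = N - \<rho> i"
      using card_greater_permutes[OF assms(1)] card_greater_permutes[OF assms(2)] by metis
    moreover have "\<pi> i \<le> N" "\<rho> i \<le> N"
      using True permutes_in_image[OF assms(1), of i] permutes_in_image[OF assms(2), of i] by auto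
    ultimately show ?thesis by linarith
  next
    case False
    then show ?thesis using assms by (simp add: permutes_not_in)
  qed
qed

lemma finite_codes: "finite (codes n)"
  unfolding codes_def by (intro finite_PiE) auto

lemma card_codes: "card (codes n) = fact n"
  unfolding codes_def by (simp add: card_PiE fact_prod)

text \<open>Injectivity holds since the code fixes the relative order and this fixes the
  permutation; surjectivity follows by counting, both sides having \<open>fact N\<close>
  elements.\<close>

lemma bij_betw_lehmer:
  "bij_betw (\<lambda>\<pi>. restrict (lehmer \<pi>) {1..N}) {\<pi>. \<pi> permutes {1..N}} (codes N)"
proof -
  let ?f = "\<lambda>\<pi>. restrict (lehmer \<pi>) {1..N}" and ?P = "{\<pi>. \<pi> permutes {1..N}}"
  have inj: "inj_on ?f ?P"
  proof (rule inj_onI)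
    fix \<pi> \<rho> assume *: "\<pi> \<in> ?P" "\<rho> \<in> ?P" "?f \<pi> = ?f \<rho>"
    have "lehmer \<pi> j = lehmer \<rho> j" if "j \<in> {1..N}" for j
      using fun_cong[OF *(3), of j] that by simp
    then have "same_rel_order N \<pi> \<rho>"
      using * by (intro same_rel_order_if_lehmer_eq) (auto intro: permutes_inj_on)
    then show "\<pi> = \<rho>" using * permutes_eq_if_same_rel_order by blast
  qed
  moreover have "?f ` ?P = codes N"
  proof (rule card_subset_eq)
    show "card (?f ` ?P) = card (codes N)"
      using card_image[OF inj] card_permutations[of "{1..N}" N] by (simp add: card_codes)
    show "?f ` ?P \<subseteq> codes N"
      using lehmer_in_codes by blast
  qed (rule finite_codes)
  ultimately show ?thesis by (simp add: bij_betw_def)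
qed

text \<open>Each inversion is counted at its later index. This is what makes the Mallows weight a
  product over the code entries.\<close>

lemma inv_count_eq_sum_lehmer: "inv_count N \<pi> = (\<Sum>i=1..N. lehmer \<pi> i)"
proof -
  let ?S = "SIGMA j:{1..N}. {i \<in> {1..<j}. \<pi> j < \<pi> i}"
  have "{(i, j). i \<in> {1..N} \<and> j \<in> {1..N} \<and> i < j \<and> \<pi> i > \<pi> j} = prod.swap ` ?S"
    by (auto simp: image_iff)
  then have "inv_count N \<pi> = card ?S"
    by (simp add: inv_count_def card_image)
  then show ?thesis by (simp add: lehmer_def)
qed

section \<open>Mallows-weighted sums over codes\<close>

definition code_sum :: "real \<Rightarrow> nat \<Rightarrow> ((nat \<Rightarrow> nat) \<Rightarrow> real) \<Rightarrow> real" where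
  "code_sum \<theta> n f = (\<Sum>c\<in>codes n. (\<Prod>i=1..n. \<theta> ^ c i) * f c)"

lemma code_sum_0: "code_sum \<theta> 0 f = f (\<lambda>_. undefined)"
  by (simp add: code_sum_def codes_def)

text \<open>One step of backward induction: the inner sum is the unnormalised conditional
  expectation given the first \<open>n\<close> entries.\<close>

lemma code_sum_Suc:
  "code_sum \<theta> (Suc n) f = code_sum \<theta> n (\<lambda>c. \<Sum>x<Suc n. \<theta> ^ x * f (c(Suc n := x)))"
proof -
  let ?g = "\<lambda>(y, c::nat \<Rightarrow> nat). c(Suc n := y)"
  have "{1..Suc n} = insert (Suc n) {1..n}" by auto
  then have "codes (Suc n) = ?g ` ({..<Suc n} \<times> codes n)"
    by (simp only: codes_def PiE_insert_eq)
  moreover have "inj_on ?g ({..<Suc n} \<times> codes n)"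
    unfolding codes_def by (rule inj_combinator) simp
  ultimately have "code_sum \<theta> (Suc n) f =
     (\<Sum>(x, c)\<in>{..<Suc n} \<times> codes n. (\<Prod>i=1..Suc n. \<theta> ^ (c(Suc n := x)) i) * f (c(Suc n := x)))"
    by (simp add: code_sum_def sum.reindex case_prod_unfold)
  also have "\<dots> = (\<Sum>(x, c)\<in>{..<Suc n} \<times> codes n. (\<Prod>i=1..n. \<theta> ^ c i) * (\<theta> ^ x * f (c(Suc n := x))))"
  proof (intro sum.cong refl, clarify)
    fix x c
    have "(\<Prod>i=1..n. \<theta> ^ (c(Suc n := x)) i) = (\<Prod>i=1..n. \<theta> ^ c i)"
      by (intro prod.cong) auto
    then show "(\<Prod>i=1..Suc n. \<theta> ^ (c(Suc n := x)) i) * f (c(Suc n := x)) =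
        (\<Prod>i=1..n. \<theta> ^ c i) * (\<theta> ^ x * f (c(Suc n := x)))"
      by simp
  qed
  also have "\<dots> = (\<Sum>x<Suc n. \<Sum>c\<in>codes n. (\<Prod>i=1..n. \<theta> ^ c i) * (\<theta> ^ x * f (c(Suc n := x))))"
    by (rule sum.cartesian_product[symmetric])
  also have "\<dots> = code_sum \<theta> n (\<lambda>c. \<Sum>x<Suc n. \<theta> ^ x * f (c(Suc n := x)))"
    unfolding code_sum_def sum_distrib_left by (rule sum.swap)
  finally show ?thesis .
qed

lemma code_sum_mono:
  assumes "\<theta> > 0" "\<And>c. f c \<le> g c"
  shows "code_sum \<theta> n f \<le> code_sum \<theta> n g"
  unfolding code_sum_def using assms by (intro sum_mono mult_left_mono prod_nonneg) auto

lemma code_sum_cong: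
  assumes "\<And>c. c \<in> codes n \<Longrightarrow> f c = g c"
  shows "code_sum \<theta> n f = code_sum \<theta> n g"
  unfolding code_sum_def using assms by (intro sum.cong) auto

lemma code_sum_mult: "code_sum \<theta> n (\<lambda>c. r * f c) = r * code_sum \<theta> n f"
  unfolding code_sum_def by (simp add: sum_distrib_left mult_ac)

lemma sum_permutes_eq_code_sum:
  "(\<Sum>\<pi> | \<pi> permutes {1..N}. \<theta> ^ inv_count N \<pi> * f (restrict (lehmer \<pi>) {1..N})) = code_sum \<theta> N f"
proof -
  have "code_sum \<theta> N f = (\<Sum>\<pi> | \<pi> permutes {1..N}.
      (\<Prod>i=1..N. \<theta> ^ restrict (lehmer \<pi>) {1..N} i) * f (restrict (lehmer \<pi>) {1..N}))"
    unfolding code_sum_def by (rule sum.reindex_bij_betw[OF bij_betw_lehmer, symmetric])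
  also have "\<dots> = (\<Sum>\<pi> | \<pi> permutes {1..N}. \<theta> ^ inv_count N \<pi> * f (restrict (lehmer \<pi>) {1..N}))"
    by (intro sum.cong refl) (simp add: inv_count_eq_sum_lehmer power_sum)
  finally show ?thesis by simp
qed

section \<open>Tracking the accepted candidate\<close>

text \<open>The state is \<open>Some p\<close> if a candidate has been accepted and \<open>p\<close> of the candidates seen so far
  beat it.\<close>

primrec track :: "(nat \<Rightarrow> bool) \<Rightarrow> (nat \<Rightarrow> nat) \<Rightarrow> nat \<Rightarrow> nat option" where
  "track e c 0 = None"
| "track e c (Suc n) = (case track e c n of
     None \<Rightarrow> if e (Suc n) then Some (c (Suc n)) else None
   | Some p \<Rightarrow> Some (if c (Suc n) \<le> p then Suc p else p))"

lemma track_cong: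
  assumes "\<And>i. i \<in> {1..n} \<Longrightarrow> e i = e' i" "\<And>i. i \<in> {1..n} \<Longrightarrow> c i = c' i"
  shows "track e c n = track e' c' n"
  using assms by (induction n) (auto split: option.splits)

text \<open>If the newcomer beats \<open>i\<close>, all who beat the newcomer also beat
  \<open>i\<close>, so its entry is at most \<open>p\<close>. Otherwise \<open>i\<close> and the
  \<open>p\<close> candidates above it all beat the newcomer, so its entry is at least
  \<open>Suc p\<close>.\<close>

lemma card_greater_Suc:
  assumes "inj_on \<pi> {1..Suc n}" "i \<in> {1..n}"
  defines "p \<equiv> card {j \<in> {1..n}. \<pi> i < \<pi> j}"
  shows "card {j \<in> {1..Suc n}. \<pi> i < \<pi> j} = (if lehmer \<pi> (Suc n) \<le> p then Suc p else p)"
proof -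
  have c: "lehmer \<pi> (Suc n) = card {j \<in> {1..n}. \<pi> (Suc n) < \<pi> j}"
    by (simp add: lehmer_def atLeastLessThanSuc_atLeastAtMost)
  have "\<pi> i \<noteq> \<pi> (Suc n)"
    using inj_onD[OF assms(1), of i "Suc n"] assms(2) by auto
  then consider "\<pi> i < \<pi> (Suc n)" | "\<pi> (Suc n) < \<pi> i" by linarith
  then show ?thesis
  proof cases
    case 1
    have "lehmer \<pi> (Suc n) \<le> p"
      unfolding c p_def using 1 by (intro card_mono) auto
    moreover have "{j \<in> {1..Suc n}. \<pi> i < \<pi> j} = insert (Suc n) {j \<in> {1..n}. \<pi> i < \<pi> j}"
      using 1 by (auto simp: le_Suc_eq)
    ultimately show ?thesis by (simp add: p_def)
  next
    case 2
    have "Suc p = card (insert i {j \<in> {1..n}. \<pi> i < \<pi> j})"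
      by (simp add: p_def)
    also have "\<dots> \<le> lehmer \<pi> (Suc n)"
      unfolding c using 2 assms(2) by (intro card_mono) auto
    finally have "Suc p \<le> lehmer \<pi> (Suc n)" .
    moreover have "{j \<in> {1..Suc n}. \<pi> i < \<pi> j} = {j \<in> {1..n}. \<pi> i < \<pi> j}"
      using 2 by (auto simp: le_Suc_eq)
    ultimately show ?thesis by (simp add: p_def)
  qed
qed

lemma track_lehmer:
  assumes "inj_on \<pi> {1..n}"
  shows "track (\<lambda>i. d i \<pi>) (lehmer \<pi>) n = None \<longleftrightarrow> (\<forall>i\<in>{1..n}. \<not> d i \<pi>)"
    and "i \<in> {1..n} \<Longrightarrow> selects d \<pi> i \<Longrightarrow>
      track (\<lambda>i. d i \<pi>) (lehmer \<pi>) n = Some (card {j \<in> {1..n}. \<pi> i < \<pi> j})"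
  using assms
proof (induction n arbitrary: i)
  case 0
  {
    case 1
    show ?case by simp
  next
    case 2
    then show ?case by simp
  }
next
  case (Suc n)
  {
    case 1
    then have "inj_on \<pi> {1..n}" by (rule inj_on_subset) auto
    moreover have "(\<forall>i\<in>{1..Suc n}. \<not> d i \<pi>) \<longleftrightarrow> \<not> d (Suc n) \<pi> \<and> (\<forall>i\<in>{1..n}. \<not> d i \<pi>)"
      by (simp add: atLeastAtMostSuc_conv)
    ultimately show ?case using Suc.IH(1) by (cases "track (\<lambda>i. d i \<pi>) (lehmer \<pi>) n") auto
  next
    case 2
    have inj: "inj_on \<pi> {1..n}" by (rule inj_on_subset[OF 2(3)]) auto
    show ?case
    proof (cases "i = Suc n")
      case True
      have "\<forall>j\<in>{1..n}. \<not> d j \<pi>" using 2(2) True by (auto simp: selects_def)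
      then have "track (\<lambda>i. d i \<pi>) (lehmer \<pi>) n = None" using Suc.IH(1)[OF inj] by simp
      moreover have "{j \<in> {1..Suc n}. \<pi> (Suc n) < \<pi> j} = {j \<in> {1..<Suc n}. \<pi> (Suc n) < \<pi> j}"
        by (auto simp: le_Suc_eq)
      then have "lehmer \<pi> (Suc n) = card {j \<in> {1..Suc n}. \<pi> (Suc n) < \<pi> j}"
        by (simp add: lehmer_def)
      ultimately show ?thesis using 2(2) True by (simp add: selects_def)
    next
      case False
      then have i: "i \<in> {1..n}" using 2(1) by auto
      then show ?thesis
        using Suc.IH(2)[OF i 2(2) inj] card_greater_Suc[OF 2(3) i] by simp
    qed
  }
qed

lemma track_lehmer_eq_Some_1_iff:
  assumes "\<pi> permutes {1..N}"
  shows "track (\<lambda>i. d i \<pi>) (lehmer \<pi>) N = Some 1 \<longleftrightarrow> (\<exists>i\<in>{1..N}. selects d \<pi> i \<and> \<pi> i = N - 1)"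
proof -
  note inj = permutes_inj_on[OF assms, of "{1..N}"]
  have key: "track (\<lambda>i. d i \<pi>) (lehmer \<pi>) N = Some 1 \<longleftrightarrow> \<pi> i = N - 1"
    if "i \<in> {1..N}" "selects d \<pi> i" for i
  proof -
    \<comment> \<open>The bounds turn the truncated equation \<open>N - \<pi> i = 1\<close> into
      \<open>\<pi> i = N - 1\<close>; positivity excludes rank 0 when \<open>N = 1\<close>.\<close>
    have "\<pi> i \<in> {1..N}" using permutes_in_image[OF assms] that(1) by blast
    then show ?thesis
      using track_lehmer(2)[OF inj that] card_greater_permutes[OF assms, of i] by auto
  qed
  show ?thesis
  proof
    assume *: "track (\<lambda>i. d i \<pi>) (lehmer \<pi>) N = Some 1"
    then have "\<exists>i. i \<in> {1..N} \<and> d i \<pi>" using track_lehmer(1)[OF inj, of d] by auto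
    then obtain i where i: "i \<in> {1..N}" "d i \<pi>" and
      least: "\<And>j. j < i \<Longrightarrow> \<not> (j \<in> {1..N} \<and> d j \<pi>)"
      using exists_least_iff[of "\<lambda>i. i \<in> {1..N} \<and> d i \<pi>"] by blast
    then have "selects d \<pi> i" by (auto simp: selects_def)
    then show "\<exists>i\<in>{1..N}. selects d \<pi> i \<and> \<pi> i = N - 1" using key i(1) * by blast
  qed (use key in blast)
qed


text \<open>Quantifying over all functions, not just codes, lets entries be overwritten without
  tracking membership in \<open>codes\<close>.\<close>

definition adapted :: "(nat \<Rightarrow> (nat \<Rightarrow> nat) \<Rightarrow> bool) \<Rightarrow> bool" where
  "adapted e \<longleftrightarrow> (\<forall>i c c'. (\<forall>j\<in>{1..i}. c j = c' j) \<longrightarrow> e i c = e i c')"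

lemma adaptedD: "adapted e \<Longrightarrow> (\<And>j. j \<in> {1..i} \<Longrightarrow> c j = c' j) \<Longrightarrow> e i c = e i c'"
  unfolding adapted_def by blast

lemma strategy_on_codes:
  assumes "strategy N d"
  obtains e where "adapted e"
    and "\<And>\<pi> i. \<pi> permutes {1..N} \<Longrightarrow> i \<in> {1..N} \<Longrightarrow> e i (restrict (lehmer \<pi>) {1..N}) = d i \<pi>"
proof -
  let ?f = "\<lambda>\<pi>. restrict (lehmer \<pi>) {1..N}"
  define decode where "decode = inv_into {\<pi>. \<pi> permutes {1..N}} ?f"
  \<comment> \<open>Future entries become 0, a value admissible at every position, so a truncated
    code is again a code. It decodes to a permutation with the same relative order up to time
    \<open>i\<close>, which a strategy cannot tell from the original.\<close>
  define trunc where "trunc i c = restrict (\<lambda>j. if j \<le> i then c j else 0) {1..N}" for i and c :: "nat \<Rightarrow> nat"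
  define e where "e i c = d i (decode (trunc i c))" for i c
  show ?thesis
  proof (rule that)
    show "adapted e"
      unfolding adapted_def
    proof (intro allI impI)
      fix i and c c' :: "nat \<Rightarrow> nat" assume "\<forall>j\<in>{1..i}. c j = c' j"
      then have "trunc i c = trunc i c'" by (auto simp: trunc_def fun_eq_iff restrict_def)
      then show "e i c = e i c'" by (simp add: e_def)
    qed
  next
    fix \<pi> i assume \<pi>: "\<pi> permutes {1..N}" and i: "i \<in> {1..N}"
    define c where "c = trunc i (?f \<pi>)"
    have c: "c \<in> codes N"
      by (auto simp: c_def trunc_def codes_def intro!: lehmer_less)
    have \<rho>: "decode c permutes {1..N}"
      using bij_betwE[OF bij_betw_inv_into[OF bij_betw_lehmer]] c by (auto simp: decode_def)
    have f: "?f (decode c) = c"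
      using bij_betw_inv_into_right[OF bij_betw_lehmer c] by (simp add: decode_def)
    have "lehmer (decode c) j = lehmer \<pi> j" if "j \<in> {1..i}" for j
    proof -
      have "lehmer (decode c) j = ?f (decode c) j" using that i by simp
      also have "\<dots> = c j" unfolding f ..
      also have "\<dots> = lehmer \<pi> j" using that i by (simp add: c_def trunc_def)
      finally show ?thesis .
    qed
    then have "same_rel_order i (decode c) \<pi>"
      using \<pi> \<rho> by (intro same_rel_order_if_lehmer_eq permutes_inj_on) auto
    then have "d i (decode c) = d i \<pi>"
      using assms[unfolded strategy_def, rule_format, OF i \<rho> \<pi>] by simp
    then show "e i (?f \<pi>) = d i \<pi>"
      by (simp only: e_def c_def)
  qed
qed

lemma strategy_reject_then_second_max: "strategy N (reject_then_second_max k)"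
  unfolding strategy_def
proof (intro ballI allI impI)
  fix i \<pi> \<rho> assume "i \<in> {1..N}" "same_rel_order i \<pi> \<rho>"
  then have "lehmer \<pi> i = lehmer \<rho> i" by (intro lehmer_cong) auto
  then show "reject_then_second_max k i \<pi> = reject_then_second_max k i \<rho>"
    by (simp add: reject_then_second_max_def flip: lehmer_eq_1_iff)
qed

section \<open>The optimal value\<close>

text \<open>The q-integer [n] at q = \<theta>: the normalising constant of the \<open>n\<close>-th
  Lehmer entry.\<close>

definition qnum :: "real \<Rightarrow> nat \<Rightarrow> real" where
  "qnum \<theta> n = (\<Sum>x<n. \<theta> ^ x)"

text \<open>Up to the common factor \<open>\<theta> ^ (2 * N - 1) / ((\<theta> - 1)\<^sup>2 * qnum \<theta> (N - 1) * qnum \<theta> N)\<close>, the following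
  are the probabilities that the candidate accepted at time \<open>n\<close> has rank \<open>N - 1\<close>, given that it is
  second best (respectively best) among the first \<open>n\<close>.\<close>

definition second_reward :: "real \<Rightarrow> nat \<Rightarrow> real" where
  "second_reward \<theta> n = (1 - (1 / \<theta>) ^ n) * (1 - (1 / \<theta>) ^ (n - 1))"

definition max_reward :: "real \<Rightarrow> nat \<Rightarrow> nat \<Rightarrow> real" where
  "max_reward \<theta> N n = (1 - (1 / \<theta>) ^ n) * ((1 / \<theta>) ^ n - (1 / \<theta>) ^ N)"

text \<open>A candidate already beaten twice can never be second best again, hence the value
  0.\<close>

definition reward :: "real \<Rightarrow> nat \<Rightarrow> nat \<Rightarrow> nat \<Rightarrow> real" where
  "reward \<theta> N n p = (if p = 0 then max_reward \<theta> N n else if p = 1 then second_reward \<theta> n else 0)"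

text \<open>The value of continuing after time \<open>n\<close> when \<open>m\<close> candidates are left, if candidates that are
  not left-to-right second maxima are never accepted.\<close>

primrec cont_value :: "real \<Rightarrow> nat \<Rightarrow> nat \<Rightarrow> real" where
  "cont_value \<theta> 0 n = 0"
| "cont_value \<theta> (Suc m) n = cont_value \<theta> m (Suc n) +
     \<theta> / qnum \<theta> (Suc n) * max 0 (second_reward \<theta> (Suc n) - cont_value \<theta> m (Suc n))"

definition state_value :: "real \<Rightarrow> nat \<Rightarrow> nat \<Rightarrow> nat option \<Rightarrow> real" where
  "state_value \<theta> N n s = (case s of None \<Rightarrow> cont_value \<theta> (N - n) n | Some p \<Rightarrow> reward \<theta> N n p)"

definition outcome_value :: "real \<Rightarrow> nat \<Rightarrow> (nat \<Rightarrow> (nat \<Rightarrow> nat) \<Rightarrow> bool) \<Rightarrow> nat \<Rightarrow> (nat \<Rightarrow> nat) \<Rightarrow> real" where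
  "outcome_value \<theta> N e n c = state_value \<theta> N n (track (\<lambda>i. e i c) c n)"

lemma second_reward_1 [simp]: "second_reward \<theta> (Suc 0) = 0"
  by (simp add: second_reward_def)

context
  fixes \<theta> :: real
  assumes theta: "\<theta> > 1"
begin

section \<open>Recursions and bounds for the rewards and the value of continuing\<close>

lemma qnum_eq: "qnum \<theta> n = (\<theta> ^ n - 1) / (\<theta> - 1)"
  using theta by (simp add: qnum_def sum_gp_strict field_simps)

lemma power_le_qnum: "\<theta> ^ n \<le> qnum \<theta> (Suc n)"
  unfolding qnum_def using theta by (simp add: sum_nonneg)

lemma qnum_Suc_ge_1: "1 \<le> qnum \<theta> (Suc n)"
  using power_le_qnum[of n] one_le_power[of \<theta> n] theta by linarith

lemma theta_le_qnum: "1 \<le> n \<Longrightarrow> \<theta> \<le> qnum \<theta> (Suc n)"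
  using power_le_qnum[of n] self_le_power[of \<theta> n] theta by linarith

lemma second_reward_nonneg: "0 \<le> second_reward \<theta> n"
  unfolding second_reward_def using theta
  by (intro mult_nonneg_nonneg) (auto intro: power_le_one)

lemma second_reward_le_1: "second_reward \<theta> n \<le> 1"
  unfolding second_reward_def using theta
  by (intro mult_le_one) (auto intro: power_le_one)

lemma second_reward_pos: "2 \<le> n \<Longrightarrow> 0 < second_reward \<theta> n"
  unfolding second_reward_def using theta
  by (intro mult_pos_pos) (auto intro!: power_Suc_less_one simp: power_less_one_iff)

lemma second_reward_mono: "m \<le> n \<Longrightarrow> second_reward \<theta> m \<le> second_reward \<theta> n"
  unfolding second_reward_def using theta
  by (intro mult_mono diff_left_mono power_decreasing) (auto intro: power_le_one)

text \<open>Conditioning on the next candidate: with weight 1 it is a new maximum and pushes the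
  current one to second place; otherwise the current one stays maximal.\<close>

lemma max_reward_rec:
  "qnum \<theta> (Suc n) * max_reward \<theta> N n =
    second_reward \<theta> (Suc n) + (qnum \<theta> (Suc n) - 1) * max_reward \<theta> N (Suc n)"
proof -
  define y Q where "y = \<theta> ^ n" and "Q = \<theta> ^ N"
  have "y > 0" "Q > 0" using theta by (auto simp: y_def Q_def)
  then show ?thesis
    using theta
    by (simp add: max_reward_def second_reward_def qnum_eq power_one_over flip: y_def Q_def)
      (simp add: field_simps)
qed

text \<open>A second-best candidate keeps its place unless the next entry is 0 or 1, of total weight
  1 + \<theta>, after which it is lost.\<close>

lemma second_reward_rec:
  assumes "1 \<le> n"
  shows "qnum \<theta> (Suc n) * second_reward \<theta> n =
    (qnum \<theta> (Suc n) - 1 - \<theta>) * second_reward \<theta> (Suc n)"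
proof -
  obtain m where n: "n = Suc m" using assms by (cases n) auto
  define y where "y = \<theta> ^ m"
  have "y > 0" using theta by (auto simp: y_def)
  then show ?thesis
    using theta
    by (simp add: n second_reward_def qnum_eq power_one_over flip: y_def)
      (simp add: field_simps)
qed

lemma cont_value_nonneg: "0 \<le> cont_value \<theta> m n"
proof (induction m arbitrary: n)
  case (Suc m)
  then show ?case using theta qnum_Suc_ge_1[of n] by simp
qed simp

lemma cont_value_Suc_le: "cont_value \<theta> m (Suc n) \<le> cont_value \<theta> (Suc m) n"
  using theta qnum_Suc_ge_1[of n] by simp

text \<open>Time 1 needs separate treatment: \<open>\<theta> / qnum \<theta> 1\<close> equals
  \<theta> > 1 and is no probability. The vanishing reward at time 1 removes that term.\<close>

lemma cont_value_Suc_0: "cont_value \<theta> (Suc m) 0 = cont_value \<theta> m (Suc 0)"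
  using cont_value_nonneg[of m "Suc 0"] by simp

lemma max_reward_le_cont_value:
  assumes "1 \<le> n" "n + m = N"
  shows "max_reward \<theta> N n \<le> cont_value \<theta> m n"
  using assms
proof (induction m arbitrary: n)
  case 0
  then show ?case by (simp add: max_reward_def)
next
  case (Suc m)
  let ?s = "qnum \<theta> (Suc n)" and ?a = "second_reward \<theta> (Suc n)" and ?v = "cont_value \<theta> m (Suc n)"
  have s: "1 \<le> ?s" by (rule qnum_Suc_ge_1)
  have "?s * max_reward \<theta> N n \<le> ?a + (?s - 1) * ?v"
    unfolding max_reward_rec using s Suc.IH[of "Suc n"] Suc.prems
    by (intro add_left_mono mult_left_mono) auto
  \<comment> \<open>The weight 1 of entry 0, which demotes a held maximum, is compared with the
    weight \<theta> of entry 1, at which a free player may take the same reward.\<close>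
  also have "\<dots> = ?s * ?v + 1 * (?a - ?v)" by (simp add: algebra_simps)
  also have "\<dots> \<le> ?s * ?v + \<theta> * max 0 (?a - ?v)"
    using theta mult_right_mono[of 1 \<theta> "max 0 (?a - ?v)"] by simp
  also have "\<dots> = ?s * cont_value \<theta> (Suc m) n"
    using s by (simp add: field_simps)
  finally show ?case using s by simp
qed

lemma sum_power_split:
  assumes "\<And>x. 2 \<le> x \<Longrightarrow> g x = r" "1 \<le> n"
  shows "(\<Sum>x<Suc n. \<theta> ^ x * g x) = g 0 + \<theta> * g 1 + (qnum \<theta> (Suc n) - 1 - \<theta>) * r"
proof -
  obtain m where n: "n = Suc m" using assms(2) by (cases n) auto
  have "(\<Sum>x<m. \<theta> * (\<theta> * \<theta> ^ x) * g (Suc (Suc x))) = (\<Sum>x<m. \<theta> * (\<theta> * \<theta> ^ x)) * r"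
    using assms(1) by (simp add: sum_distrib_right)
  then show ?thesis
    by (simp add: n qnum_def sum.lessThan_Suc_shift del: sum.lessThan_Suc)
qed

text \<open>After acceptance no decision remains, so the reward is a martingale; the cases
  \<open>p = 0\<close> and \<open>p = 1\<close> are the two reward recursions.\<close>

lemma accepted_step:
  assumes "1 \<le> n"
  shows "(\<Sum>x<Suc n. \<theta> ^ x * reward \<theta> N (Suc n) (if x \<le> p then Suc p else p)) =
    qnum \<theta> (Suc n) * reward \<theta> N n p"
proof -
  consider "p = 0" | "p = 1" | "2 \<le> p" by linarith
  then show ?thesis
  proof cases
    case 1
    show ?thesis
      by (subst sum_power_split[where r = "max_reward \<theta> N (Suc n)"])
        (use assms max_reward_rec[of n N] in \<open>auto simp: 1 reward_def algebra_simps\<close>)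
  next
    case 2
    show ?thesis
      by (subst sum_power_split[where r = "second_reward \<theta> (Suc n)"])
        (use assms second_reward_rec[of n] in \<open>auto simp: 2 reward_def\<close>)
  next
    case 3
    then show ?thesis by (auto simp: reward_def simp del: sum.lessThan_Suc intro!: sum.neutral)
  qed
qed

lemma unaccepted_optimal_step:
  fixes m n :: nat
  defines "v \<equiv> cont_value \<theta> m (Suc n)"
  shows "(\<Sum>x<Suc n. \<theta> ^ x * (if x = 1 then max (second_reward \<theta> (Suc n)) v else v)) =
    qnum \<theta> (Suc n) * cont_value \<theta> (Suc m) n"
proof (cases "n = 0")
  case True
  then show ?thesis
    unfolding True cont_value_Suc_0 by (simp add: True v_def qnum_def)
next
  case False
  then have "(\<Sum>x<Suc n. \<theta> ^ x * (if x = 1 then max (second_reward \<theta> (Suc n)) v else v)) =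
      v + \<theta> * max (second_reward \<theta> (Suc n)) v + (qnum \<theta> (Suc n) - 1 - \<theta>) * v"
    by (subst sum_power_split[where r = v]) auto
  also have "\<dots> = qnum \<theta> (Suc n) * cont_value \<theta> (Suc m) n"
    using qnum_Suc_ge_1[of n] by (simp add: field_simps max_def flip: v_def)
  finally show ?thesis .
qed

text \<open>The bound holds entry by entry: accepting at entry 0 gives at most \<open>v\<close> by
  \<open>max_reward_le_cont_value\<close>, and at entries from 2 on it gives 0. Only entry 1 offers
  a genuine choice.\<close>

lemma unaccepted_step:
  fixes m n :: nat and e :: "nat \<Rightarrow> bool"
  defines "v \<equiv> cont_value \<theta> m (Suc n)" and "N \<equiv> Suc (n + m)"
  defines "t \<equiv> (\<lambda>x. if e x then reward \<theta> N (Suc n) x else v)"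
  shows "(\<Sum>x<Suc n. \<theta> ^ x * t x) \<le> qnum \<theta> (Suc n) * cont_value \<theta> (Suc m) n"
    and "(\<And>x. e x \<longleftrightarrow> x = 1 \<and> v \<le> second_reward \<theta> (Suc n)) \<Longrightarrow>
      (\<Sum>x<Suc n. \<theta> ^ x * t x) = qnum \<theta> (Suc n) * cont_value \<theta> (Suc m) n"
proof -
  let ?h = "\<lambda>x. if x = 1 then max (second_reward \<theta> (Suc n)) v else v"
  have "max_reward \<theta> N (Suc n) \<le> v" "0 \<le> v"
    unfolding v_def using max_reward_le_cont_value cont_value_nonneg by (auto simp: N_def)
  then have "t x \<le> ?h x" for x
    by (auto simp: t_def reward_def)
  then have "(\<Sum>x<Suc n. \<theta> ^ x * t x) \<le> (\<Sum>x<Suc n. \<theta> ^ x * ?h x)"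
    using theta by (intro sum_mono mult_left_mono) auto
  then show "(\<Sum>x<Suc n. \<theta> ^ x * t x) \<le> qnum \<theta> (Suc n) * cont_value \<theta> (Suc m) n"
    unfolding v_def unaccepted_optimal_step .
  assume e: "\<And>x. e x \<longleftrightarrow> x = 1 \<and> v \<le> second_reward \<theta> (Suc n)"
  have "(\<Sum>x<Suc n. \<theta> ^ x * t x) = (\<Sum>x<Suc n. \<theta> ^ x * ?h x)"
    by (intro sum.cong refl) (auto simp: t_def reward_def e)
  then show "(\<Sum>x<Suc n. \<theta> ^ x * t x) = qnum \<theta> (Suc n) * cont_value \<theta> (Suc m) n"
    unfolding v_def unaccepted_optimal_step .
qed

section \<open>Values of adapted rules by backward induction\<close>

context
  fixes N :: nat and e :: "nat \<Rightarrow> (nat \<Rightarrow> nat) \<Rightarrow> bool"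
  assumes adapted: "adapted e"
begin

lemma track_update:
  "track (\<lambda>i. e i (c(Suc n := x))) (c(Suc n := x)) n = track (\<lambda>i. e i c) c n"
  by (rule track_cong) (auto intro!: adaptedD[OF adapted])

text \<open>After normalisation by \<open>qnum\<close>, the outcome value is a supermartingale under
  any adapted rule, and a martingale under the rule that accepts second maxima as soon as this is no
  worse than continuing.\<close>

lemma outcome_value_step:
  assumes "n < N"
  shows "(\<Sum>x<Suc n. \<theta> ^ x * outcome_value \<theta> N e (Suc n) (c(Suc n := x))) \<le>
      qnum \<theta> (Suc n) * outcome_value \<theta> N e n c"
    and "(\<And>c. e (Suc n) c \<longleftrightarrow>
        c (Suc n) = 1 \<and> cont_value \<theta> (N - Suc n) (Suc n) \<le> second_reward \<theta> (Suc n)) \<Longrightarrow>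
      (\<Sum>x<Suc n. \<theta> ^ x * outcome_value \<theta> N e (Suc n) (c(Suc n := x))) =
      qnum \<theta> (Suc n) * outcome_value \<theta> N e n c"
proof -
  define m where "m = N - Suc n"
  have N: "N = Suc (n + m)" using assms by (simp add: m_def)
  let ?L = "\<Sum>x<Suc n. \<theta> ^ x * outcome_value \<theta> N e (Suc n) (c(Suc n := x))"
  have "?L \<le> qnum \<theta> (Suc n) * outcome_value \<theta> N e n c \<and>
    ((\<forall>c. e (Suc n) c \<longleftrightarrow> c (Suc n) = 1 \<and> cont_value \<theta> m (Suc n) \<le> second_reward \<theta> (Suc n)) \<longrightarrow>
      ?L = qnum \<theta> (Suc n) * outcome_value \<theta> N e n c)"
  proof (cases "track (\<lambda>i. e i c) c n")
    case None
    have "outcome_value \<theta> N e (Suc n) (c(Suc n := x)) =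
      (if e (Suc n) (c(Suc n := x)) then reward \<theta> N (Suc n) x else cont_value \<theta> m (Suc n))" for x
      by (simp add: outcome_value_def state_value_def track_update None m_def)
    moreover have "outcome_value \<theta> N e n c = cont_value \<theta> (Suc m) n"
      using N by (simp add: outcome_value_def state_value_def None del: cont_value.simps)
    ultimately show ?thesis
      using unaccepted_step[where n = n and m = m and e = "\<lambda>x. e (Suc n) (c(Suc n := x))"] N
      by (auto simp del: cont_value.simps sum.lessThan_Suc)
  next
    case (Some p)
    then have "1 \<le> n" by (cases n) auto
    then show ?thesis
      using accepted_step[of n N p]
      by (simp add: outcome_value_def state_value_def track_update Some del: sum.lessThan_Suc)
  qed
  then show "?L \<le> qnum \<theta> (Suc n) * outcome_value \<theta> N e n c"
    and "(\<And>c. e (Suc n) c \<longleftrightarrow>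
        c (Suc n) = 1 \<and> cont_value \<theta> (N - Suc n) (Suc n) \<le> second_reward \<theta> (Suc n)) \<Longrightarrow>
      ?L = qnum \<theta> (Suc n) * outcome_value \<theta> N e n c"
    by (simp_all add: m_def del: sum.lessThan_Suc)
qed

lemma code_sum_outcome_value_le:
  "n \<le> N \<Longrightarrow> code_sum \<theta> n (outcome_value \<theta> N e n) \<le> (\<Prod>i=1..n. qnum \<theta> i) * cont_value \<theta> N 0"
proof (induction n)
  case 0
  then show ?case by (simp add: code_sum_0 outcome_value_def state_value_def)
next
  case (Suc n)
  have "code_sum \<theta> (Suc n) (outcome_value \<theta> N e (Suc n)) \<le>
      code_sum \<theta> n (\<lambda>c. qnum \<theta> (Suc n) * outcome_value \<theta> N e n c)"
    unfolding code_sum_Suc using theta Suc.prems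
    by (intro code_sum_mono outcome_value_step(1)) auto
  also have "\<dots> = qnum \<theta> (Suc n) * code_sum \<theta> n (outcome_value \<theta> N e n)"
    by (rule code_sum_mult)
  also have "\<dots> \<le> qnum \<theta> (Suc n) * ((\<Prod>i=1..n. qnum \<theta> i) * cont_value \<theta> N 0)"
    using Suc qnum_Suc_ge_1[of n] by (intro mult_left_mono) auto
  finally show ?case by (simp add: mult_ac)
qed

lemma code_sum_outcome_value_eq:
  assumes "\<And>i c. i \<in> {1..N} \<Longrightarrow> e i c \<longleftrightarrow> c i = 1 \<and> cont_value \<theta> (N - i) i \<le> second_reward \<theta> i"
  shows "n \<le> N \<Longrightarrow> code_sum \<theta> n (outcome_value \<theta> N e n) = (\<Prod>i=1..n. qnum \<theta> i) * cont_value \<theta> N 0"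
proof (induction n)
  case 0
  then show ?case by (simp add: code_sum_0 outcome_value_def state_value_def)
next
  case (Suc n)
  have "code_sum \<theta> (Suc n) (outcome_value \<theta> N e (Suc n)) =
      code_sum \<theta> n (\<lambda>c. qnum \<theta> (Suc n) * outcome_value \<theta> N e n c)"
    unfolding code_sum_Suc using assms[of "Suc n"] Suc.prems
    by (intro code_sum_cong outcome_value_step(2)) auto
  also have "\<dots> = qnum \<theta> (Suc n) * code_sum \<theta> n (outcome_value \<theta> N e n)"
    by (rule code_sum_mult)
  finally show ?case using Suc by (simp add: mult_ac)
qed

text \<open>At time \<open>N\<close> both \<open>max_reward\<close> and the value of continuing
  vanish, so only the state \<open>Some 1\<close> pays.\<close>

lemma code_sum_win:
  "code_sum \<theta> N (outcome_value \<theta> N e N) =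
    second_reward \<theta> N * code_sum \<theta> N (\<lambda>c. of_bool (track (\<lambda>i. e i c) c N = Some 1))"
  unfolding code_sum_mult[symmetric]
  by (intro code_sum_cong)
    (auto simp: outcome_value_def state_value_def reward_def max_reward_def split: option.splits)

lemma win_prob_eq:
  assumes "\<And>\<pi> i. \<pi> permutes {1..N} \<Longrightarrow> i \<in> {1..N} \<Longrightarrow> e i (restrict (lehmer \<pi>) {1..N}) = d i \<pi>"
  shows "win_prob \<theta> N d * (\<Sum>\<rho> | \<rho> permutes {1..N}. \<theta> ^ inv_count N \<rho>) =
    code_sum \<theta> N (\<lambda>c. of_bool (track (\<lambda>i. e i c) c N = Some 1))"
proof -
  let ?P = "{\<pi>. \<pi> permutes {1..N}}"
  let ?Z = "\<Sum>\<rho>\<in>?P. \<theta> ^ inv_count N \<rho>"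
  let ?win = "\<lambda>\<pi>. \<exists>i\<in>{1..N}. selects d \<pi> i \<and> \<pi> i = N - 1"
  have fin: "finite ?P" by (rule finite_permutations) simp
  have "?P \<noteq> {}" using permutes_id by blast
  then have Z: "?Z > 0" using fin theta by (intro sum_pos) auto
  \<comment> \<open>The event in \<open>win_prob\<close> ranges over all functions; the support cuts
    it down to permutations, making the probability a finite sum.\<close>
  have sub: "set_pmf (mallows \<theta> N) \<subseteq> ?P"
    using theta by (auto simp: set_pmf_iff pmf_mallows split: if_splits)
  have "win_prob \<theta> N d = measure_pmf.prob (mallows \<theta> N) {\<pi> \<in> ?P. ?win \<pi>}"
    unfolding win_prob_def using sub
    by (intro measure_pmf.finite_measure_eq_AE) (auto simp: AE_measure_pmf_iff)
  also have "\<dots> = (\<Sum>\<pi> | \<pi> \<in> ?P \<and> ?win \<pi>. pmf (mallows \<theta> N) \<pi>)"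
    using fin by (intro measure_measure_pmf_finite) auto
  also have "\<dots> = (\<Sum>\<pi> | \<pi> \<in> ?P \<and> ?win \<pi>. \<theta> ^ inv_count N \<pi> / ?Z)"
    using theta by (intro sum.cong) (auto simp: pmf_mallows)
  also have "\<dots> = (\<Sum>\<pi> | \<pi> \<in> ?P \<and> ?win \<pi>. \<theta> ^ inv_count N \<pi>) / ?Z"
    by (rule sum_divide_distrib[symmetric])
  finally have "win_prob \<theta> N d * ?Z = (\<Sum>\<pi> | \<pi> \<in> ?P \<and> ?win \<pi>. \<theta> ^ inv_count N \<pi>)"
    using Z by simp
  also have "\<dots> = (\<Sum>\<pi>\<in>?P. \<theta> ^ inv_count N \<pi> * of_bool (?win \<pi>))"
    using fin by (intro sum.mono_neutral_cong_left) auto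
  also have "\<dots> = (\<Sum>\<pi>\<in>?P. \<theta> ^ inv_count N \<pi> *
     of_bool (track (\<lambda>i. e i (restrict (lehmer \<pi>) {1..N})) (restrict (lehmer \<pi>) {1..N}) N = Some 1))"
  proof (intro sum.cong refl)
    fix \<pi> assume "\<pi> \<in> ?P"
    then have \<pi>: "\<pi> permutes {1..N}" by simp
    have "track (\<lambda>i. e i (restrict (lehmer \<pi>) {1..N})) (restrict (lehmer \<pi>) {1..N}) N =
        track (\<lambda>i. d i \<pi>) (lehmer \<pi>) N"
      by (rule track_cong) (use assms[OF \<pi>] in auto)
    then show "\<theta> ^ inv_count N \<pi> * of_bool (?win \<pi>) = \<theta> ^ inv_count N \<pi> *
     of_bool (track (\<lambda>i. e i (restrict (lehmer \<pi>) {1..N})) (restrict (lehmer \<pi>) {1..N}) N = Some 1)"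
      using track_lehmer_eq_Some_1_iff[OF \<pi>, of d] by presburger
  qed
  also have "\<dots> = code_sum \<theta> N (\<lambda>c. of_bool (track (\<lambda>i. e i c) c N = Some 1))"
    by (rule sum_permutes_eq_code_sum)
  finally show ?thesis .
qed

end

text \<open>Every strategy is bounded by the same multiple of
  \<open>cont_value \<theta> N 0\<close>, and the threshold rule attains it. The common factor
  \<open>second_reward \<theta> N\<close> can be cancelled because it is positive for
  \<open>N\<close> at least 2.\<close>

lemma optimal_reject_then_second_max:
  assumes "2 \<le> N"
    and k: "\<And>i. i \<in> {1..N} \<Longrightarrow> k < i \<longleftrightarrow> cont_value \<theta> (N - i) i \<le> second_reward \<theta> i"
  shows "optimal_strategy \<theta> N (reject_then_second_max k)"
  unfolding optimal_strategy_def
proof (intro conjI allI impI)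
  show "strategy N (reject_then_second_max k)" by (rule strategy_reject_then_second_max)
next
  fix d assume "strategy N d"
  then obtain e where adapted: "adapted e"
    and e: "\<And>\<pi> i. \<pi> permutes {1..N} \<Longrightarrow> i \<in> {1..N} \<Longrightarrow> e i (restrict (lehmer \<pi>) {1..N}) = d i \<pi>"
    using strategy_on_codes by blast
  define e' :: "nat \<Rightarrow> (nat \<Rightarrow> nat) \<Rightarrow> bool" where "e' i c \<longleftrightarrow> k < i \<and> i \<noteq> 0 \<and> c i = 1" for i c
  have adapted': "adapted e'"
    by (auto simp: adapted_def e'_def)
  have e': "e' i (restrict (lehmer \<pi>) {1..N}) = reject_then_second_max k i \<pi>"
    if "\<pi> permutes {1..N}" "i \<in> {1..N}" for \<pi> i
    using that lehmer_eq_1_iff[of \<pi> i] by (simp add: e'_def reject_then_second_max_def)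
  let ?Z = "\<Sum>\<rho> | \<rho> permutes {1..N}. \<theta> ^ inv_count N \<rho>"
  have Z: "?Z > 0"
    using theta finite_permutations[of "{1..N}"] permutes_id[of "{1..N}"]
    by (intro sum_pos) (auto intro: exI[of _ id])
  have "second_reward \<theta> N * (win_prob \<theta> N d * ?Z) = code_sum \<theta> N (outcome_value \<theta> N e N)"
    by (simp only: win_prob_eq[where e = e and d = d, OF adapted e] code_sum_win[OF adapted])
  also have "\<dots> \<le> (\<Prod>i=1..N. qnum \<theta> i) * cont_value \<theta> N 0"
    by (rule code_sum_outcome_value_le[OF adapted order.refl])
  also have "\<dots> = code_sum \<theta> N (outcome_value \<theta> N e' N)"
    by (rule code_sum_outcome_value_eq[OF adapted' _ order.refl, symmetric]) (auto simp: e'_def k)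
  also have "\<dots> = second_reward \<theta> N * (win_prob \<theta> N (reject_then_second_max k) * ?Z)"
    by (simp only: win_prob_eq[where e = e' and d = "reject_then_second_max k", OF adapted' e']
        code_sum_win[OF adapted'])
  finally show "win_prob \<theta> N d \<le> win_prob \<theta> N (reject_then_second_max k)"
    using second_reward_pos[OF assms(1)] Z by simp
qed

section \<open>Stabilisation of the threshold\<close>

lemma cont_value_mono_Suc: "cont_value \<theta> m n \<le> cont_value \<theta> (Suc m) n"
proof (induction m arbitrary: n)
  case 0
  then show ?case using cont_value_nonneg[of 1 n] by simp
next
  case (Suc m)
  let ?a = "second_reward \<theta> (Suc n)"
  \<comment> \<open>As a function of \<open>v\<close> this is piecewise linear with slopes
    \<open>1 - r\<close> and 1, both nonnegative.\<close>
  have mono: "v + r * max 0 (a - v) \<le> w + r * max 0 (a - w)"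
    if "v \<le> w" "0 \<le> r" "r \<le> 1" for v w r a :: real
  proof -
    have "r * (max 0 (a - v) - max 0 (a - w)) \<le> 1 * (w - v)"
      using that by (intro mult_mono) auto
    then show ?thesis by (simp add: algebra_simps)
  qed
  show ?case
  proof (cases "n = 0")
    \<comment> \<open>Here \<open>r\<close> would be \<theta> > 1, so monotonicity is inherited from
      time 1 instead.\<close>
    case True
    then show ?thesis using Suc.IH[of "Suc 0"] by (metis cont_value_Suc_0)
  next
    case False
    then have "\<theta> / qnum \<theta> (Suc n) \<le> 1" "0 \<le> \<theta> / qnum \<theta> (Suc n)"
      using theta theta_le_qnum[of n] by auto
    then show ?thesis
      using mono[OF Suc.IH[of "Suc n"]] cont_value.simps(2) by metis
  qed
qed

lemma cont_value_mono: "m \<le> m' \<Longrightarrow> cont_value \<theta> m n \<le> cont_value \<theta> m' n"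
  by (rule lift_Suc_mono_le[of "\<lambda>m. cont_value \<theta> m n"]) (rule cont_value_mono_Suc)

text \<open>Rewards are at most 1, and a second maximum appears at time \<open>Suc j\<close> with
  chance at most \<open>\<theta> * (1 / \<theta>) ^ j\<close>. The bound is the geometric tail of
  these chances over \<open>j \<ge> n\<close>; its constant \<open>?D\<close> solves
  \<open>?D / \<theta> + \<theta> = ?D\<close>.\<close>

lemma cont_value_le: "cont_value \<theta> m n \<le> \<theta> / (1 - 1 / \<theta>) * (1 / \<theta>) ^ n"
proof (induction m arbitrary: n)
  case 0
  then show ?case using theta by simp
next
  case (Suc m)
  let ?D = "\<theta> / (1 - 1 / \<theta>)"
  have r: "\<theta> / qnum \<theta> (Suc n) \<le> \<theta> * (1 / \<theta>) ^ n"
    using theta power_le_qnum[of n] by (simp add: power_one_over divide_left_mono frac_le)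
  have "cont_value \<theta> (Suc m) n \<le> ?D * (1 / \<theta>) ^ Suc n + \<theta> * (1 / \<theta>) ^ n * 1"
    unfolding cont_value.simps using theta r Suc.IH[of "Suc n"] second_reward_le_1[of "Suc n"]
      cont_value_nonneg[of m "Suc n"]
    by (intro add_mono mult_mono) auto
  also have "\<dots> = (?D * (1 / \<theta>) + \<theta>) * (1 / \<theta>) ^ n"
    unfolding power_Suc by (simp only: ring_distribs mult_ac mult_1_right)
  also have "?D * (1 / \<theta>) + \<theta> = ?D"
    using theta by (simp add: field_simps)
  finally show ?case .
qed

lemma eventually_cont_value_le:
  "\<forall>\<^sub>F n in sequentially. \<forall>m. cont_value \<theta> m n \<le> second_reward \<theta> n"
proof -
  let ?D = "\<theta> / (1 - 1 / \<theta>)"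
  have q: "(\<lambda>n. (1 / \<theta>) ^ n) \<longlonglongrightarrow> 0"
    using theta by (intro LIMSEQ_realpow_zero) auto
  have q': "(\<lambda>n. (1 / \<theta>) ^ (n - 1)) \<longlonglongrightarrow> 0"
    by (rule LIMSEQ_imp_Suc) (simp add: q)
  have "(\<lambda>n. second_reward \<theta> n - ?D * (1 / \<theta>) ^ n) \<longlonglongrightarrow> (1 - 0) * (1 - 0) - ?D * 0"
    unfolding second_reward_def by (intro tendsto_intros q q')
  then have "\<forall>\<^sub>F n in sequentially. 0 < second_reward \<theta> n - ?D * (1 / \<theta>) ^ n"
    by (rule order_tendstoD) simp
  then show ?thesis
  proof eventually_elim
    case (elim n)
    then show ?case using cont_value_le[of _ n] by (smt (verit))
  qed
qed

text \<open>Monotonicity in \<open>N\<close> rules out a threshold that oscillates because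
  of a tie in the limit problem.\<close>

lemma threshold:
  "\<exists>k. \<forall>\<^sub>F N in sequentially.
    \<forall>i\<in>{1..N}. k < i \<longleftrightarrow> cont_value \<theta> (N - i) i \<le> second_reward \<theta> i"
proof -
  define rej where "rej N n \<longleftrightarrow> second_reward \<theta> n < cont_value \<theta> (N - n) n" for N n
  \<comment> \<open>Inserting 0 makes the maximum exist; it is the threshold when no time is ever
    rejected.\<close>
  define B where "B = insert 0 {n. \<exists>N. rej N n}"
  have rej_mono: "rej N' n" if "rej N n" "N \<le> N'" for N N' n
    using that cont_value_mono[OF diff_le_mono, of N N' n n] by (simp add: rej_def)
  have rej_Suc: "rej N n" if "rej N (Suc n)" for N n
  proof (cases "n < N")
    case True
    then have "cont_value \<theta> (N - Suc n) (Suc n) \<le> cont_value \<theta> (N - n) n"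
      using cont_value_Suc_le[of "N - Suc n" n] by (metis Suc_diff_Suc)
    then show ?thesis
      using that second_reward_mono[of n "Suc n"] by (simp add: rej_def)
  next
    \<comment> \<open>No candidates are left, so continuing is worth 0 and cannot exceed a
      nonnegative reward.\<close>
    case False
    then show ?thesis using that second_reward_nonneg[of "Suc n"] by (simp add: rej_def)
  qed
  have rej_down: "rej N i" if "i \<le> n" "rej N n" for N i n
    using that by (induction rule: inc_induct) (auto intro: rej_Suc)
  obtain n0 where n0: "\<And>n m. n0 \<le> n \<Longrightarrow> cont_value \<theta> m n \<le> second_reward \<theta> n"
    using eventually_cont_value_le by (auto simp: eventually_sequentially)
  have "n \<le> n0" if "rej N n" for N n
    using that n0[of n "N - n"] by (cases "n0 \<le> n") (auto simp: rej_def)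
  then have "B \<subseteq> {..n0}" by (auto simp: B_def)
  then have fin: "finite B" by (rule finite_subset) simp
  define k where "k = Max B"
  have "k \<in> B" unfolding k_def using fin by (intro Max_in) (auto simp: B_def)
  \<comment> \<open>One \<open>N0\<close> rejecting at \<open>k\<close> suffices: rejection passes
    down to earlier times and up to larger \<open>N\<close>. For \<open>k = 0\<close> no index
    \<open>i \<ge> 1\<close> has to be rejected.\<close>
  obtain N0 where N0: "k \<noteq> 0 \<Longrightarrow> rej N0 k"
    using \<open>k \<in> B\<close> by (auto simp: B_def)
  have "k < i \<longleftrightarrow> \<not> rej N i" if "N0 \<le> N" "i \<in> {1..N}" for N i
  proof
    assume "k < i"
    then have "i \<notin> B" unfolding k_def using Max_ge[OF fin] by (metis leD)
    then show "\<not> rej N i" by (auto simp: B_def)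
  next
    assume *: "\<not> rej N i"
    show "k < i"
    proof (rule ccontr)
      assume "\<not> k < i"
      then have "rej N i" using that N0 rej_down[of i k N0] rej_mono[of N0 i N] by auto
      with * show False by simp
    qed
  qed
  then show ?thesis
    unfolding eventually_sequentially rej_def not_less by blast
qed

end

theorem theorem9:
  fixes \<theta> :: real
  assumes "\<theta> > 1"
  shows "\<exists>k::nat. \<forall>\<^sub>F N in sequentially. optimal_strategy \<theta> N (reject_then_second_max k)"
proof -
  obtain k where "\<forall>\<^sub>F N in sequentially.
      \<forall>i\<in>{1..N}. k < i \<longleftrightarrow> cont_value \<theta> (N - i) i \<le> second_reward \<theta> i"
    using threshold[OF assms] by blast
  then have "\<forall>\<^sub>F N in sequentially. optimal_strategy \<theta> N (reject_then_second_max k)"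
    using eventually_ge_at_top[of 2]
    by eventually_elim (use optimal_reject_then_second_max[OF assms] in blast)
  then show ?thesis ..
qed

end
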